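(* Let $j$ be a non-negative integer and $m$ a positive integer. For $|q|<1$, and for either choice of sign (upper signs throughout, or lower signs throughout), \begin{enumerate} \item[(i)] $\displaystyle V^{\pm}_{j,m}(q) = (\pm q;q)_m^2 \sum_{k=j}^\infty (\pm 1)^{k-j} B_{k,j}\,q^k\,H_{k,m}(q,q^2)$; \item[(ii)] $\displaystyle W^{\pm}_{j,m}(q) = (\pm q;q^2)^2_m \sum_{k=j}^\infty (\pm 1)^{k-j} B_{k,j}\,q^k\,H_{k,m}(q^2,q^2)$. \end{enumerate}
   Context: For $n\ge 0$, $(a;q)_n=\prod_{r=0}^{n-1}(1-aq^r)$ with $(a;q)_0=1$. For integers $m,k$ and a base $p$, the Gaussian polynomial is ${m \brack k}_p=\frac{(p;p)_m}{(p;p)_k(p;p)_{m-k}}$ if $0\le k\le m$ and $0$ otherwise. For non-negative integers $k,m$ define $$V^{\pm}_{k,m}(q)=\sum_{1\le n_1\le n_2\le\cdots\le n_k\le m}\prod_{i=1}^k\frac{q^{n_i}}{(1\mp q^{n_i})^2},\qquad W^{\pm}_{k,m}(q)=\sum_{1\le n_1\le\cdots\le n_k\le m}\prod_{i=1}^k\frac{q^{2n_i-1}}{(1\mp q^{2n_i-1})^2},$$ with $V^{\pm}_{0,m}(q)=W^{\pm}_{0,m}(q)=1$. Define $$H_{k,m}(p,z)=\sum_{i=0}^\infty {m-1+i \brack i}_p {m-1+k+i \brack k+i}_p z^{i}.$$ The coefficients $B_{k,j}$ (for $k\ge j\ge 0$) are $B_{0,0}=1$, $B_{k,0}=2$ for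 $k\ge1$, and $B_{k,j}=\frac{2k}{k+j}\binom{k+j}{2j}$ for $j\ge1$, $k\ge j$. *)

theory Defs
  imports Complex_Main
begin

definition qpoch :: "complex \<Rightarrow> complex \<Rightarrow> nat \<Rightarrow> complex" where
  "qpoch a q n = (\<Prod>r<n. 1 - a * q ^ r)"

definition gauss_poly :: "int \<Rightarrow> int \<Rightarrow> complex \<Rightarrow> complex" where
  "gauss_poly m k p =
     (if 0 \<le> k \<and> k \<le> m
      then qpoch p p (nat m) / (qpoch p p (nat k) * qpoch p p (nat (m - k)))
      else 0)"

text \<open>The tuples \<open>1 \<le> n\<^sub>1 \<le> \<dots> \<le> n\<^sub>k \<le> m\<close>; the entry \<open>n\<^sub>i\<close> is \<open>ns ! (i - 1)\<close>.\<close>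

definition nondecr_tuples :: "nat \<Rightarrow> nat \<Rightarrow> nat list set" where
  "nondecr_tuples k m = {ns. length ns = k \<and> sorted ns \<and> set ns \<subseteq> {1..m}}"

text \<open>In \<open>V\<close> and \<open>W\<close> the argument \<open>s\<close> is the sign in the superscript: \<open>s = 1\<close> for the
  upper sign (denominators \<open>(1 - q\<^sup>n)\<^sup>2\<close>) and \<open>s = -1\<close> for the lower sign
  (denominators \<open>(1 + q\<^sup>n)\<^sup>2\<close>).\<close>

definition V :: "complex \<Rightarrow> nat \<Rightarrow> nat \<Rightarrow> complex \<Rightarrow> complex" where
  "V s k m q =
     (\<Sum>ns\<in>nondecr_tuples k m. \<Prod>i<k. q ^ (ns ! i) / (1 - s * q ^ (ns ! i))\<^sup>2)"

definition W :: "complex \<Rightarrow> nat \<Rightarrow> nat \<Rightarrow> complex \<Rightarrow> complex" where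
  "W s k m q =
     (\<Sum>ns\<in>nondecr_tuples k m.
        \<Prod>i<k. q ^ (2 * (ns ! i) - 1) / (1 - s * q ^ (2 * (ns ! i) - 1))\<^sup>2)"

definition H_term :: "nat \<Rightarrow> nat \<Rightarrow> complex \<Rightarrow> complex \<Rightarrow> nat \<Rightarrow> complex" where
  "H_term k m p z i =
     gauss_poly (int m - 1 + int i) (int i) p *
     gauss_poly (int m - 1 + int k + int i) (int k + int i) p * z ^ i"

definition H :: "nat \<Rightarrow> nat \<Rightarrow> complex \<Rightarrow> complex \<Rightarrow> complex" where
  "H k m p z = (\<Sum>i. H_term k m p z i)"

definition B :: "nat \<Rightarrow> nat \<Rightarrow> complex" where
  "B k j =
     (if j = 0 then (if k = 0 then 1 else 2)
      else of_nat (2 * k) / of_nat (k + j) * of_nat ((k + j) choose (2 * j)))"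

end

theory Submission
  imports Defs "HOL-Analysis.Infinite_Sum"
begin

text \<open>
  Put \<open>x\<^sub>n = q p\<^sup>n\<close> with \<open>p = q\<close> or \<open>p = q\<^sup>2\<close>. Then \<open>V\<close> and \<open>W\<close> are the complete homogeneous
  symmetric polynomials of the numbers \<open>x\<^sub>n / (1 - s x\<^sub>n)\<^sup>2\<close>, with generating function
  \<open>\<Prod> (1 - s x\<^sub>n)\<^sup>2 / (1 - (2 s + t) x\<^sub>n + x\<^sub>n\<^sup>2)\<close> in \<open>t\<close>. If \<open>w + 1 / w = 2 s + t\<close>, the denominator
  is \<open>(1 - w x\<^sub>n) (1 - x\<^sub>n / w)\<close>, so the product of its inverses is the double series
  \<open>\<Sum> h\<^sub>a h\<^sub>b w\<^bsup>a - b\<^esup>\<close> in the complete homogeneous polynomials \<open>h\<^sub>a\<close> of the \<open>x\<^sub>n\<close>, which are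
  Gaussian polynomials; \<open>B\<close> lists the coefficients of \<open>w\<^sup>k + w\<^bsup>-k\<^esup>\<close> as a polynomial in \<open>t\<close>.
  To avoid comparing power series in \<open>t\<close>, the coefficients of this double series are handled
  directly: the three-term recurrence of \<open>w\<^sup>k + w\<^bsup>-k\<^esup>\<close> and \<open>h\<^sub>a = h'\<^sub>a - x h'\<^sub>a\<^sub>-\<^sub>1\<close>, where
  \<open>h'\<close> includes the additional variable \<open>x\<close>, show that they obey the same recursion in the
  number of variables as \<open>V\<close> and \<open>W\<close>.
\<close>

section \<open>Complete homogeneous symmetric polynomials\<close>

fun chsym :: "(nat \<Rightarrow> 'a::comm_ring_1) \<Rightarrow> nat \<Rightarrow> nat \<Rightarrow> 'a" where
  "chsym x 0 a = (if a = 0 then 1 else 0)"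
| "chsym x (Suc m) 0 = 1"
| "chsym x (Suc m) (Suc a) = chsym x m (Suc a) + x m * chsym x (Suc m) a"

lemma chsym_0_right [simp]: "chsym x m 0 = 1"
  by (cases m) auto

lemma finite_nondecr_tuples: "finite (nondecr_tuples k m)"
proof -
  have "nondecr_tuples k m \<subseteq> {ns. set ns \<subseteq> {1..m} \<and> length ns = k}"
    by (auto simp: nondecr_tuples_def)
  then show ?thesis
    using finite_lists_length_eq[of "{1..m}" k] finite_subset by blast
qed

lemma nondecr_tuples_0: "nondecr_tuples 0 m = {[]}"
  by (auto simp: nondecr_tuples_def)

lemma nondecr_tuples_Suc_0: "nondecr_tuples (Suc k) 0 = {}"
  by (auto simp: nondecr_tuples_def)

text \<open>Sortedness puts the largest entry last: either it equals \<open>Suc m\<close> and can be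
  stripped off, or \<open>Suc m\<close> does not occur at all. This is the recursion of
  \<open>chsym\<close>.\<close>

lemma nondecr_tuples_Suc_Suc:
  "nondecr_tuples (Suc k) (Suc m) =
     nondecr_tuples (Suc k) m \<union> (\<lambda>ns. ns @ [Suc m]) ` nondecr_tuples k (Suc m)"
proof (rule set_eqI)
  fix ns :: "nat list"
  show "ns \<in> nondecr_tuples (Suc k) (Suc m) \<longleftrightarrow>
    ns \<in> nondecr_tuples (Suc k) m \<union> (\<lambda>ns. ns @ [Suc m]) ` nondecr_tuples k (Suc m)"
  proof (cases ns rule: rev_cases)
    case Nil
    then show ?thesis by (auto simp: nondecr_tuples_def)
  next
    case (snoc ys y)
    have "Suc m \<notin> set ys" if "sorted (ys @ [y])" "y \<le> m"
      using that by (auto simp: sorted_append)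
    then show ?thesis
      by (cases "y = Suc m")
        (auto simp: nondecr_tuples_def snoc sorted_append image_iff le_Suc_eq subset_iff)
  qed
qed

lemma sum_nondecr_tuples_eq_chsym:
  fixes f :: "nat \<Rightarrow> complex"
  shows "(\<Sum>ns\<in>nondecr_tuples k m. \<Prod>i<k. f (ns ! i)) = chsym (\<lambda>n. f (Suc n)) m k"
proof (induction "\<lambda>n. f (Suc n)" m k rule: chsym.induct)
  case (1 a)
  then show ?case by (cases a) (simp_all add: nondecr_tuples_0 nondecr_tuples_Suc_0)
next
  case (2 m)
  then show ?case by (simp add: nondecr_tuples_0)
next
  case (3 m k)
  have disj: "nondecr_tuples (Suc k) m \<inter> (\<lambda>ns. ns @ [Suc m]) ` nondecr_tuples k (Suc m) = {}"
    by (auto simp: nondecr_tuples_def)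
  have "(\<Sum>ns\<in>(\<lambda>ns. ns @ [Suc m]) ` nondecr_tuples k (Suc m). \<Prod>i<Suc k. f (ns ! i)) =
      (\<Sum>ns\<in>nondecr_tuples k (Suc m). \<Prod>i<Suc k. f ((ns @ [Suc m]) ! i))"
    by (subst sum.reindex) (auto simp: inj_on_def)
  also have "\<dots> = (\<Sum>ns\<in>nondecr_tuples k (Suc m). (\<Prod>i<k. f (ns ! i)) * f (Suc m))"
  proof (rule sum.cong)
    fix ns assume "ns \<in> nondecr_tuples k (Suc m)"
    then have len: "length ns = k" by (simp add: nondecr_tuples_def)
    then have "(\<Prod>i<k. f ((ns @ [Suc m]) ! i)) = (\<Prod>i<k. f (ns ! i))"
      by (intro prod.cong) (auto simp: nth_append)
    with len show "(\<Prod>i<Suc k. f ((ns @ [Suc m]) ! i)) = (\<Prod>i<k. f (ns ! i)) * f (Suc m)"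
      by (simp add: nth_append)
  qed simp
  also have "\<dots> = f (Suc m) * chsym (\<lambda>n. f (Suc n)) (Suc m) k"
    unfolding sum_distrib_right[symmetric] 3(2) by (rule mult.commute)
  finally show ?case
    unfolding nondecr_tuples_Suc_Suc chsym.simps 3(1)[symmetric]
    by (subst sum.union_disjoint[OF _ _ disj]) (simp_all add: finite_nondecr_tuples)
qed

section \<open>q-Pochhammer symbols and Gaussian polynomials\<close>

lemma qpoch_Suc: "qpoch a q (Suc n) = qpoch a q n * (1 - a * q ^ n)"
  by (simp add: qpoch_def)

lemma qpoch_Suc_left: "qpoch a q (Suc n) = (1 - a) * qpoch (a * q) q n"
  unfolding qpoch_def prod.lessThan_Suc_shift by (simp add: mult.assoc)

lemma qpoch_add: "qpoch a q (m + n) = qpoch a q m * qpoch (a * q ^ m) q n"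
  by (induction n) (simp_all add: qpoch_def power_add mult.assoc)

lemma qpoch_self_nonzero:
  assumes "norm p < 1"
  shows "qpoch p p n \<noteq> 0"
proof -
  have "1 - p * p ^ r \<noteq> 0" for r
  proof
    assume "1 - p * p ^ r = 0"
    then have "norm (p ^ Suc r) = 1" by simp
    moreover have "norm (p ^ Suc r) < 1"
      using assms power_Suc_less_one[of "norm p" r]
      by (simp add: norm_power norm_mult power_less_one_iff mult_le_one
          flip: power_Suc)
    ultimately show False by simp
  qed
  then show ?thesis by (simp add: qpoch_def)
qed

text \<open>Principal specialisation: for variables in geometric progression the recursion of
  \<open>chsym\<close> becomes the q-Pascal rule. The quotient of q-Pochhammer symbols is also right
  for \<open>m = 0\<close>, where the induction starts.\<close>

lemma chsym_geometric:
  assumes "norm p < 1"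
  shows "chsym (\<lambda>n. u * p ^ n) m a = u ^ a * (qpoch (p ^ m) p a / qpoch p p a)"
proof (induction "\<lambda>n. u * p ^ n" m a rule: chsym.induct)
  case (1 a)
  then show ?case by (cases a) (simp_all add: qpoch_Suc_left, simp add: qpoch_def)
next
  case (2 m)
  then show ?case by (simp add: qpoch_def)
next
  case (3 m a)
  define R where "R = qpoch (p ^ Suc m) p a"
  define D where "D = qpoch p p a"
  have D: "D \<noteq> 0" "1 - p * p ^ a \<noteq> 0"
    using qpoch_self_nonzero[OF assms, of "Suc a"] by (auto simp: D_def qpoch_Suc)
  have "qpoch (p ^ m) p (Suc a) = (1 - p ^ m) * R"
    by (simp add: qpoch_Suc_left R_def mult.commute)
  moreover have "qpoch (p ^ Suc m) p (Suc a) = R * (1 - p ^ m * (p * p ^ a))"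
    by (simp add: qpoch_Suc R_def mult_ac)
  moreover have "qpoch p p (Suc a) = D * (1 - p * p ^ a)"
    by (simp add: qpoch_Suc D_def)
  ultimately show ?case
    using D unfolding chsym.simps 3(1) 3(2)
    by (simp del: power_Suc add: R_def[symmetric] D_def[symmetric])
      (simp add: divide_simps, simp add: algebra_simps)
qed

lemma gauss_poly_eq:
  assumes "norm p < 1" "m \<ge> 1"
  shows "gauss_poly (int m - 1 + int a) (int a) p = qpoch (p ^ m) p a / qpoch p p a"
proof -
  obtain n where m: "m = Suc n" using assms(2) by (cases m) auto
  have "gauss_poly (int m - 1 + int a) (int a) p =
      qpoch p p (n + a) / (qpoch p p a * qpoch p p n)"
    by (simp add: gauss_poly_def m nat_add_distrib)
  then show ?thesis
    using qpoch_self_nonzero[OF assms(1)] by (simp add: qpoch_add m)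
qed

text \<open>Since \<open>q ^ k * (q\<^sup>2) ^ i = q ^ i * q ^ (i + k)\<close>, the powers of
  \<open>q\<close> split between the two Gaussian polynomials. Hence
  \<open>q ^ k * H k m p (q\<^sup>2)\<close> is an autocorrelation of the sequence of complete
  homogeneous polynomials.\<close>

lemma H_term_mult_power:
  assumes "norm p < 1" "m \<ge> 1"
  shows "q ^ k * H_term k m p (q\<^sup>2) i =
     chsym (\<lambda>n. q * p ^ n) m i * chsym (\<lambda>n. q * p ^ n) m (i + k)"
proof -
  have "int m - 1 + int k + int i = int m - 1 + int (i + k)" "int k + int i = int (i + k)"
    by simp_all
  then show ?thesis
    unfolding H_term_def chsym_geometric[OF assms(1)]
    by (simp only: gauss_poly_eq[OF assms])
      (simp add: power_add power2_eq_square power_mult_distrib)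
qed

section \<open>The coefficients\<close>

text \<open>Truncated subtraction gives \<open>Bsym 0 0 = 2\<close>, the value of \<open>w\<^sup>0 + w\<^sup>-\<^sup>0\<close>, whereas \<open>B 0 0 = 1\<close>;
  this makes the recurrence hold from \<open>k = 0\<close> on.\<close>

definition Bsym :: "nat \<Rightarrow> nat \<Rightarrow> nat" where
  "Bsym k j = ((k + j) choose (2 * j)) + ((k + j - 1) choose (2 * j))"

lemma choose_second_difference:
  "(Suc (Suc n) choose Suc (Suc i)) + (n choose Suc (Suc i)) =
     2 * (Suc n choose Suc (Suc i)) + (n choose i)"
  by simp

lemma Bsym_0_right: "Bsym k 0 = 2"
  by (simp add: Bsym_def)

lemma Bsym_0_left: "Bsym 0 (Suc j) = 0"
  by (simp add: Bsym_def)

lemma Bsym_1_left: "Bsym 1 (Suc j) = (if j = 0 then 1 else 0)"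
  by (simp add: Bsym_def)

text \<open>A second difference in the upper index of a binomial lowers the bottom index by two;
  this is applied to both summands of \<open>Bsym\<close>.\<close>

lemma Bsym_recurrence:
  "Bsym (Suc (Suc k)) (Suc j) + Bsym k (Suc j) = 2 * Bsym (Suc k) (Suc j) + Bsym (Suc k) j"
  using choose_second_difference[of "k + Suc j" "2 * j"]
    choose_second_difference[of "k + j" "2 * j"]
  by (simp add: Bsym_def)

lemma Bsym_eq_B:
  assumes "k + j \<ge> 1"
  shows "of_nat (Bsym k j) = B k j"
proof (cases "j = 0")
  case True
  then show ?thesis using assms by (simp add: B_def Bsym_0_right)
next
  case False
  then obtain n where n: "k + j = Suc n" by (cases "k + j") auto
  \<comment> \<open>Absorption gives \<open>(k + j) * ((k + j - 1) choose (2 * j)) = (k - j) * ((k +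
    j) choose (2 * j))\<close>, and \<open>(k + j) + (k - j) = 2 * k\<close>.\<close>
  have "(k + j) * Bsym k j = 2 * k * ((k + j) choose (2 * j))"
  proof (cases "j \<le> k")
    case True
    have "Suc n * (n choose (2 * j)) = (Suc n - 2 * j) * (Suc n choose (2 * j))"
      using binomial_absorb_comp[of "Suc n" "2 * j"] by simp
    moreover have "Suc n - 2 * j = k - j" using n by simp
    moreover have "Suc n + (k - j) = 2 * k" using n True by simp
    ultimately have "Suc n * Bsym k j = 2 * k * (Suc n choose (2 * j))"
      unfolding Bsym_def n by (metis add_mult_distrib add_mult_distrib2 diff_Suc_1)
    then show ?thesis by (simp add: n)
  next
    case False
    then show ?thesis by (simp add: Bsym_def binomial_eq_0)
  qed
  then have "of_nat (k + j) * of_nat (Bsym k j) =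
      (of_nat (2 * k) * of_nat ((k + j) choose (2 * j)) :: complex)"
    by (metis of_nat_mult)
  then show ?thesis
    using False n by (simp add: B_def field_simps del: of_nat_Suc of_nat_add)
qed

text \<open>With \<open>w + 1 / w = 2 * s + t\<close>, \<open>ccoeff s j d\<close> is the coefficient of \<open>t ^ j\<close> in
  \<open>(w ^ d + w ^ (- d)) / 2\<close>.\<close>

definition ccoeff :: "complex \<Rightarrow> nat \<Rightarrow> int \<Rightarrow> complex" where
  "ccoeff s j d = s ^ (nat \<bar>d\<bar> + j) * of_nat (Bsym (nat \<bar>d\<bar>) j) / 2"

lemma ccoeff_uminus: "ccoeff s j (- d) = ccoeff s j d"
  by (simp add: ccoeff_def)

text \<open>Coefficient form of (w + 1/w) (w^d + w^-d) = (w^(d+1) + w^-(d+1)) + (w^(d-1) + w^-(d-1))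
  with w + 1/w = 2 s + t. Positive d reduces to \<open>Bsym_recurrence\<close>, d = 0 is checked
  directly, and negative d follows by evenness.\<close>

lemma ccoeff_recurrence:
  assumes "s * s = 1"
  shows "ccoeff s j (d + 1) + ccoeff s j (d - 1) =
    2 * s * ccoeff s j d + (if j = 0 then 0 else ccoeff s (j - 1) d)"
proof -
  have ss: "s * (s * y) = y" for y
    by (simp add: mult.assoc[symmetric] assms)
  have nonneg: "ccoeff s j (d + 1) + ccoeff s j (d - 1) =
    2 * s * ccoeff s j d + (if j = 0 then 0 else ccoeff s (j - 1) d)" if d: "d \<ge> 0" for d
  proof -
    obtain k where k: "d = int k" using zero_le_imp_eq_int[OF d] by blast
    show ?thesis
    proof (cases k)
      case 0
      have nat: "nat \<bar>d + 1\<bar> = 1" "nat \<bar>d - 1\<bar> = 1" "nat \<bar>d\<bar> = 0"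
        using k 0 by auto
      show ?thesis
      proof (cases j)
        case 0
        then show ?thesis by (simp add: ccoeff_def nat Bsym_0_right)
      next
        case (Suc i)
        then show ?thesis
          by (cases i) (simp_all add: ccoeff_def nat Bsym_0_right Bsym_0_left Bsym_1_left ss assms power2_eq_square
              del: One_nat_def)
      qed
    next
      case (Suc k')
      have nat: "nat \<bar>d + 1\<bar> = Suc (Suc k')" "nat \<bar>d - 1\<bar> = k'" "nat \<bar>d\<bar> = Suc k'"
        using k Suc by auto
      show ?thesis
      proof (cases j)
        case 0
        then show ?thesis by (simp add: ccoeff_def nat Bsym_0_right ss)
      next
        case (Suc i)
        have "of_nat (Bsym (Suc (Suc k')) (Suc i)) + of_nat (Bsym k' (Suc i)) =
            (2 * of_nat (Bsym (Suc k') (Suc i)) + of_nat (Bsym (Suc k') i) :: complex)"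
          by (metis Bsym_recurrence of_nat_add of_nat_mult of_nat_numeral)
        then have eq: "E * of_nat (Bsym (Suc (Suc k')) (Suc i)) + E * of_nat (Bsym k' (Suc i)) =
            2 * (E * of_nat (Bsym (Suc k') (Suc i))) + E * of_nat (Bsym (Suc k') i)" for E :: complex
          by (simp add: mult.left_commute flip: distrib_left)
        define E where "E = s ^ (k' + Suc i)"
        have "s ^ (Suc (Suc k') + Suc i) = E" "s ^ (Suc k' + Suc i) = s * E" "s ^ (Suc k' + i) = E"
          by (simp_all add: E_def ss)
        then show ?thesis
          using eq[of E] unfolding ccoeff_def nat Suc
          by (simp add: E_def[symmetric] ss mult.assoc flip: add_divide_distrib)
      qed
    qed
  qed
  show ?thesis
  proof (cases "d \<ge> 0")
    case False
    have "ccoeff s j (d + 1) = ccoeff s j (- (d + 1))" "ccoeff s j (d - 1) = ccoeff s j (- (d - 1))"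
      by (simp_all only: ccoeff_uminus)
    then have "ccoeff s j (d + 1) + ccoeff s j (d - 1) =
        ccoeff s j (- d + 1) + ccoeff s j (- d - 1)"
      by (simp add: minus_diff_commute)
    also have "\<dots> = 2 * s * ccoeff s j d + (if j = 0 then 0 else ccoeff s (j - 1) d)"
      using nonneg[of "- d"] False by (simp only: ccoeff_uminus)
    finally show ?thesis .
  qed (rule nonneg)
qed

text \<open>The growth in d is only polynomial, so any rate \<open>r > 1\<close> dominates it.
  Explicitly, one term of the binomial expansion of \<open>(y + 1) ^ (k + j)\<close> with
  \<open>y = r - 1\<close> bounds the binomial coefficient.\<close>

lemma norm_ccoeff_le:
  assumes "norm s = 1" "r > 1"
  obtains K where "\<And>d. norm (ccoeff s j d) \<le> K * r ^ nat \<bar>d\<bar>"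
proof -
  define y where "y = r - 1"
  have y: "y > 0" using assms by (simp add: y_def)
  have le: "norm (ccoeff s j d) \<le> r ^ j / y ^ (2 * j) * r ^ nat \<bar>d\<bar>" for d
  proof -
    define k where "k = nat \<bar>d\<bar>"
    have "Bsym k j \<le> 2 * ((k + j) choose (2 * j))"
      using binomial_right_mono[of "k + j - 1" "k + j" "2 * j"] by (simp add: Bsym_def)
    then have b: "real (Bsym k j) \<le> 2 * real ((k + j) choose (2 * j))"
      by (metis of_nat_le_iff of_nat_mult of_nat_numeral)
    have "real ((k + j) choose (2 * j)) * y ^ (2 * j) \<le> (y + 1) ^ (k + j)"
    proof (cases "2 * j \<le> k + j")
      case True
      show ?thesis
        unfolding binomial_ring
        using y True
        by (intro order_trans[OF _ member_le_sum[where i = "2 * j"]]) auto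
    next
      case False
      then show ?thesis using y by (simp add: binomial_eq_0)
    qed
    then have "real ((k + j) choose (2 * j)) \<le> r ^ (k + j) / y ^ (2 * j)"
      using y by (simp add: field_simps y_def)
    with b have "real (Bsym k j) / 2 \<le> r ^ j / y ^ (2 * j) * r ^ k"
      by (simp add: power_add mult.commute)
    then show ?thesis
      using assms(1) by (simp add: ccoeff_def norm_mult norm_power norm_divide flip: k_def)
  qed
  show thesis by (rule that[OF le])
qed

section \<open>Weighted double series\<close>

text \<open>Summing the recursion bounds each partial sum of \<open>f\<close> by
  \<open>suminf g\<close> plus \<open>c\<close> times itself, hence by
  \<open>suminf g / (1 - c)\<close>.\<close>

lemma summable_contracting_recurrence:
  fixes f g :: "nat \<Rightarrow> real"
  assumes f: "\<And>n. f n \<ge> 0" and g: "\<And>n. g n \<ge> 0" "summable g"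
    and c: "0 \<le> c" "c < 1" and rec: "f 0 \<le> g 0" "\<And>n. f (Suc n) \<le> g (Suc n) + c * f n"
  shows "summable f"
proof (rule summableI_nonneg_bounded)
  fix n
  have "(\<Sum>i<Suc n. f i) \<le> (\<Sum>i<Suc n. g i) + c * (\<Sum>i<n. f i)"
    unfolding sum.lessThan_Suc_shift[of f] sum.lessThan_Suc_shift[of g] sum_distrib_left
    using rec(1) sum_mono[of "{..<n}" "\<lambda>i. f (Suc i)" "\<lambda>i. g (Suc i) + c * f i"] rec(2)
    by (simp add: sum.distrib)
  moreover have "(\<Sum>i<n. f i) \<le> (\<Sum>i<Suc n. f i)"
    using f by simp
  moreover have "(\<Sum>i<Suc n. g i) \<le> suminf g"
    using g by (intro sum_le_suminf) auto
  ultimately have "(1 - c) * (\<Sum>i<n. f i) \<le> suminf g"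
    by (simp add: algebra_simps)
  then show "(\<Sum>i<n. f i) \<le> suminf g / (1 - c)"
    using c by (simp add: field_simps)
qed (rule f)

text \<open>Each added variable contributes a geometric factor of ratio at most
  \<open>r * \<rho>\<close>. A weight with \<open>r > 1\<close> leaves room for the growth of
  \<open>ccoeff\<close>.\<close>

lemma summable_chsym:
  fixes x :: "nat \<Rightarrow> complex"
  assumes "\<And>n. norm (x n) \<le> \<rho>" "r > 0" "r * \<rho> < 1"
  shows "summable (\<lambda>a. norm (chsym x m a) * r ^ a)"
proof (induction m)
  case 0
  have "summable (\<lambda>a. norm (chsym x 0 a) * r ^ a)"
    by (rule summable_finite[of "{0}"]) auto
  then show ?case .
next
  case (Suc m)
  have \<rho>: "\<rho> \<ge> 0" using assms(1)[of 0] norm_ge_zero order_trans by blast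
  show ?case
  proof (rule summable_contracting_recurrence[OF _ _ Suc, where c = "r * \<rho>"])
    fix n
    have "norm (chsym x (Suc m) (Suc n)) \<le>
        norm (chsym x m (Suc n)) + \<rho> * norm (chsym x (Suc m) n)"
      by (auto intro!: norm_triangle_le add_mono mult_right_mono assms(1) simp: norm_mult)
    then show "norm (chsym x (Suc m) (Suc n)) * r ^ Suc n \<le>
        norm (chsym x m (Suc n)) * r ^ Suc n + r * \<rho> * (norm (chsym x (Suc m) n) * r ^ n)"
      using mult_right_mono[of _ _ "r ^ Suc n"] assms(2) by (fastforce simp: algebra_simps)
  qed (use assms \<rho> in auto)
qed

text \<open>For \<open>c d\<close> equal to w^d this is formally the product of the generating
  functions of \<open>v\<close> at w and at 1/w. An unordered sum permits both shifting and
  regrouping by diagonals.\<close>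

definition toeplitz_sum :: "(int \<Rightarrow> complex) \<Rightarrow> (nat \<Rightarrow> complex) \<Rightarrow> complex" where
  "toeplitz_sum c v = (\<Sum>\<^sub>\<infinity>(a, b)\<in>UNIV. c (int a - int b) * v a * v b)"

lemma toeplitz_abs_summable:
  fixes c :: "int \<Rightarrow> complex" and v :: "nat \<Rightarrow> complex"
  assumes r: "r \<ge> 1" and v: "summable (\<lambda>a. norm (v a) * r ^ a)"
    and c: "\<And>d. norm (c d) \<le> K * r ^ nat \<bar>d\<bar>"
  shows "(\<lambda>(a, b). c (int a - int b) * v a * v b) abs_summable_on UNIV"
proof -
  define g where "g a = norm (v a) * r ^ a" for a
  have g0: "g a \<ge> 0" for a using r by (simp add: g_def)
  have gs: "g summable_on UNIV"
    using v g0 by (subst summable_on_UNIV_nonneg_real_iff) (auto simp: g_def[abs_def])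
  have "(\<lambda>(a, b). g a * g b) abs_summable_on (UNIV \<times> UNIV)"
    unfolding abs_summable_on_Sigma_iff
    using g0 gs by (auto simp: infsum_cmult_right' abs_mult infsum_nonneg
        intro!: summable_on_cmult_right summable_on_cmult_left)
  then have *: "(\<lambda>(a, b). g a * g b) summable_on UNIV"
    using g0 by (simp add: case_prod_unfold)
  have K: "K \<ge> 0" using c[of 0] norm_ge_zero[of "c 0"] by (auto simp del: norm_ge_zero)
  show ?thesis
  proof (rule abs_summable_on_comparison_test')
    show "(\<lambda>z. K * (case z of (a, b) \<Rightarrow> g a * g b)) summable_on UNIV"
      by (rule summable_on_cmult_right[OF *])
    fix z :: "nat \<times> nat"
    obtain a b where z: "z = (a, b)" by (cases z)
    \<comment> \<open>As |a - b| is at most a + b, the weight splits into a product and the double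
      family is dominated by \<open>g a * g b\<close>.\<close>
    have "norm (c (int a - int b)) \<le> K * r ^ (a + b)"
      using c[of "int a - int b"] K r
      by (elim order_trans) (auto intro!: mult_left_mono power_increasing)
    then have "norm (c (int a - int b)) * (norm (v a) * norm (v b)) \<le>
        K * r ^ (a + b) * (norm (v a) * norm (v b))"
      by (intro mult_right_mono) auto
    then show "norm (case z of (a, b) \<Rightarrow> c (int a - int b) * v a * v b) \<le>
        K * (case z of (a, b) \<Rightarrow> g a * g b)"
      by (simp add: z g_def norm_mult power_add mult_ac)
  qed
qed

lemma toeplitz_has_sum:
  fixes c :: "int \<Rightarrow> complex" and v :: "nat \<Rightarrow> complex"
  assumes "r \<ge> 1" "summable (\<lambda>a. norm (v a) * r ^ a)" "\<And>d. norm (c d) \<le> K * r ^ nat \<bar>d\<bar>"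
  shows "((\<lambda>(a, b). c (int a - int b) * v a * v b) has_sum toeplitz_sum c v) UNIV"
  unfolding toeplitz_sum_def
  by (rule has_sum_infsum[OF abs_summable_summable[OF toeplitz_abs_summable[OF assms]]])

text \<open>Passing from \<open>v\<close> to \<open>u\<close> removes one variable \<open>x\<close>:
  it multiplies the two generating functions by (1 - x w) (1 - x/w) = 1 - x (w + 1/w) + x^2.
  Multiplication by w + 1/w acts on \<open>c\<close> as the sum of the two unit shifts, which
  \<open>rec\<close> evaluates.\<close>

lemma toeplitz_sum_geometric_factor:
  fixes c :: "int \<Rightarrow> complex" and u v :: "nat \<Rightarrow> complex"
  assumes r: "r \<ge> 1" and v: "summable (\<lambda>a. norm (v a) * r ^ a)"
    and c: "\<And>d. norm (c d) \<le> K * r ^ nat \<bar>d\<bar>" and e: "\<And>d. norm (e d) \<le> L * r ^ nat \<bar>d\<bar>"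
    and u: "u 0 = v 0" "\<And>a. u (Suc a) = v (Suc a) - x * v a"
    and rec: "\<And>d. c (d + 1) + c (d - 1) = t * c d + e d"
  shows "toeplitz_sum c u = (1 - t * x + x\<^sup>2) * toeplitz_sum c v - x * toeplitz_sum e v"
proof -
  \<comment> \<open>The delayed sequence, with 0 in place of the missing entry of \<open>v\<close>
    at -1. Expanding \<open>u = v - x * z\<close> gives four shifted copies of the double
    sum.\<close>
  define z where "z a = (case a of 0 \<Rightarrow> 0 | Suc a \<Rightarrow> v a)" for a
  have z: "z 0 = 0" "z (Suc a) = v a" for a by (simp_all add: z_def)
  have u': "u a = v a - x * z a" for a by (cases a) (simp_all add: z u)
  have K: "K \<ge> 0" using c[of 0] norm_ge_zero[of "c 0"] by (auto simp del: norm_ge_zero)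
  have shifted: "norm (c (d + i)) \<le> K * r * r ^ nat \<bar>d\<bar>" if "\<bar>i\<bar> \<le> 1" for d i
  proof -
    have "norm (c (d + i)) \<le> K * r ^ nat \<bar>d + i\<bar>" by (rule c)
    also have "\<dots> \<le> K * r ^ Suc (nat \<bar>d\<bar>)"
      using K r that by (intro mult_left_mono power_increasing) auto
    finally show ?thesis by (simp add: mult.assoc)
  qed
  define c1 where "c1 d = c (d + 1)" for d
  define c2 where "c2 d = c (d + - 1)" for d
  define T where "T = toeplitz_sum c v"
  have h0: "((\<lambda>(a, b). c (int a - int b) * v a * v b) has_sum T) UNIV"
    unfolding T_def by (rule toeplitz_has_sum[OF r v c])
  have h1: "((\<lambda>(a, b). c1 (int a - int b) * v a * v b) has_sum toeplitz_sum c1 v) UNIV"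
    by (rule toeplitz_has_sum[OF r v]) (unfold c1_def, rule shifted, simp)
  have h2: "((\<lambda>(a, b). c2 (int a - int b) * v a * v b) has_sum toeplitz_sum c2 v) UNIV"
    by (rule toeplitz_has_sum[OF r v]) (unfold c2_def, rule shifted, simp)
  have he: "((\<lambda>(a, b). e (int a - int b) * v a * v b) has_sum toeplitz_sum e v) UNIV"
    by (rule toeplitz_has_sum[OF r v e])
  \<comment> \<open>Undoes a delay by reindexing; index pairs outside the range of the shift
    contribute nothing because \<open>z 0 = 0\<close>.\<close>
  have embed: "(f has_sum S) UNIV"
    if "((\<lambda>p. f (h p)) has_sum S) UNIV" "inj h" "\<And>p. p \<notin> range h \<Longrightarrow> f p = 0"
    for f :: "nat \<times> nat \<Rightarrow> complex" and h :: "nat \<times> nat \<Rightarrow> nat \<times> nat" and S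
  proof -
    have "(f has_sum S) (range h)"
      using that(1,2) by (simp add: has_sum_reindex o_def)
    then show ?thesis
      using that(3) by (subst has_sum_cong_neutral[where T = "range h" and g = f]) auto
  qed
  have k1: "((\<lambda>(a, b). c (int a - int b) * z a * v b) has_sum toeplitz_sum c1 v) UNIV"
  proof (rule embed[where h = "\<lambda>(a, b). (Suc a, b)"])
    show "((\<lambda>p. case case p of (a, b) \<Rightarrow> (Suc a, b) of
        (a, b) \<Rightarrow> c (int a - int b) * z a * v b) has_sum toeplitz_sum c1 v) UNIV"
      using h1 by (simp add: case_prod_unfold z c1_def algebra_simps)
    fix p :: "nat \<times> nat" assume "p \<notin> range (\<lambda>(a, b). (Suc a, b))"
    then show "(case p of (a, b) \<Rightarrow> c (int a - int b) * z a * v b) = 0"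
      by (cases p; cases "fst p") (auto simp: z image_iff)
  qed (auto simp: inj_def)
  have k2: "((\<lambda>(a, b). c (int a - int b) * v a * z b) has_sum toeplitz_sum c2 v) UNIV"
  proof (rule embed[where h = "\<lambda>(a, b). (a, Suc b)"])
    show "((\<lambda>p. case case p of (a, b) \<Rightarrow> (a, Suc b) of
        (a, b) \<Rightarrow> c (int a - int b) * v a * z b) has_sum toeplitz_sum c2 v) UNIV"
      using h2 by (simp add: case_prod_unfold z c2_def algebra_simps)
    fix p :: "nat \<times> nat" assume "p \<notin> range (\<lambda>(a, b). (a, Suc b))"
    then show "(case p of (a, b) \<Rightarrow> c (int a - int b) * v a * z b) = 0"
      by (cases p; cases "snd p") (auto simp: z image_iff)
  qed (auto simp: inj_def)
  have k3: "((\<lambda>(a, b). c (int a - int b) * z a * z b) has_sum T) UNIV"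
  proof (rule embed[where h = "\<lambda>(a, b). (Suc a, Suc b)"])
    show "((\<lambda>p. case case p of (a, b) \<Rightarrow> (Suc a, Suc b) of
        (a, b) \<Rightarrow> c (int a - int b) * z a * z b) has_sum T) UNIV"
      using h0 by (simp add: case_prod_unfold z)
    fix p :: "nat \<times> nat" assume "p \<notin> range (\<lambda>(a, b). (Suc a, Suc b))"
    then show "(case p of (a, b) \<Rightarrow> c (int a - int b) * z a * z b) = 0"
      by (cases p; cases "fst p"; cases "snd p") (auto simp: z image_iff)
  qed (auto simp: inj_def)
  have "((\<lambda>(a, b). c (int a - int b) * u a * u b) has_sum
      (T + (- x) * toeplitz_sum c1 v + (- x) * toeplitz_sum c2 v + x\<^sup>2 * T)) UNIV"
    using has_sum_add[OF has_sum_add[OF has_sum_add[OF h0 has_sum_cmult_right[OF k1, of "- x"]]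
          has_sum_cmult_right[OF k2, of "- x"]] has_sum_cmult_right[OF k3, of "x\<^sup>2"]]
    by (rule has_sum_cong[THEN iffD1, rotated])
      (auto simp: u' algebra_simps power2_eq_square)
  then have Tu: "toeplitz_sum c u =
      T + (- x) * toeplitz_sum c1 v + (- x) * toeplitz_sum c2 v + x\<^sup>2 * T"
    unfolding toeplitz_sum_def by (rule infsumI)
  have "((\<lambda>(a, b). t * (c (int a - int b) * v a * v b) + e (int a - int b) * v a * v b)
      has_sum (toeplitz_sum c1 v + toeplitz_sum c2 v)) UNIV"
    using has_sum_add[OF h1 h2]
  proof (rule has_sum_cong[THEN iffD1, rotated])
    fix p :: "nat \<times> nat"
    obtain a b where p: "p = (a, b)" by (cases p)
    have "(c (int a - int b + 1) + c (int a - int b - 1)) * (v a * v b) =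
        (t * c (int a - int b) + e (int a - int b)) * (v a * v b)"
      by (simp only: rec)
    then show "(case p of (a, b) \<Rightarrow> c1 (int a - int b) * v a * v b) +
          (case p of (a, b) \<Rightarrow> c2 (int a - int b) * v a * v b) =
        (case p of (a, b) \<Rightarrow> t * (c (int a - int b) * v a * v b) + e (int a - int b) * v a * v b)"
      by (simp add: p c1_def c2_def algebra_simps)
  qed
  moreover have "((\<lambda>(a, b). t * (c (int a - int b) * v a * v b) + e (int a - int b) * v a * v b)
      has_sum (t * T + toeplitz_sum e v)) UNIV"
    using has_sum_add[OF has_sum_cmult_right[OF h0, of t] he] by (simp add: case_prod_unfold)
  ultimately have "toeplitz_sum c1 v + toeplitz_sum c2 v = t * T + toeplitz_sum e v"
    by (rule has_sum_unique)
  then have "x * (toeplitz_sum c1 v + toeplitz_sum c2 v) = x * (t * T + toeplitz_sum e v)"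
    by simp
  then show ?thesis
    unfolding Tu T_def[symmetric] by (simp add: algebra_simps)
qed

text \<open>The pairs (i, i + k) form one diagonal of the absolutely summable double family with
  constant weight 1.\<close>

lemma summable_autocorrelation:
  fixes v :: "nat \<Rightarrow> complex"
  assumes r: "r \<ge> 1" and v: "summable (\<lambda>a. norm (v a) * r ^ a)"
  shows "(\<lambda>i. v i * v (i + k)) abs_summable_on UNIV"
proof -
  have "(\<lambda>(a, b). 1 * v a * v b) abs_summable_on UNIV"
    using r by (intro toeplitz_abs_summable[OF r v, where c = "\<lambda>_. 1" and K = 1]) auto
  then have "(\<lambda>(a, b). v a * v b) abs_summable_on range (\<lambda>i. (i, i + k))"
    unfolding mult_1_left by (rule summable_on_subset_banach) simp
  then show ?thesis
    by (subst (asm) summable_on_reindex) (simp_all add: inj_def o_def)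
qed

text \<open>The diagonals at offsets k and -k agree by evenness of \<open>c\<close>, so every
  diagonal but the main one counts twice.\<close>

lemma toeplitz_sum_by_diagonals:
  fixes c :: "int \<Rightarrow> complex" and v :: "nat \<Rightarrow> complex"
  assumes r: "r \<ge> 1" and v: "summable (\<lambda>a. norm (v a) * r ^ a)"
    and c: "\<And>d. norm (c d) \<le> K * r ^ nat \<bar>d\<bar>" and even: "\<And>d. c (- d) = c d"
  shows "(\<lambda>k. (if k = 0 then 1 else 2) * c (int k) * (\<Sum>i. v i * v (i + k)))
    sums toeplitz_sum c v"
proof -
  define f where "f = (\<lambda>(a, b). c (int a - int b) * v a * v b)"
  define g where "g = (\<lambda>(k, i). c (int k) * (v i * v (i + k)))"
  define t where "t k = c (int k) * (\<Sum>i. v i * v (i + k))" for k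
  \<comment> \<open>\<open>up\<close> lists the pairs on or above the diagonal and \<open>dn\<close>
    those strictly below; the offset \<open>Suc k\<close> keeps the main diagonal from being counted
    twice.\<close>
  define up where "up = (\<lambda>(k, i::nat). (i, i + k))"
  define dn where "dn = (\<lambda>(k, i::nat). (i + Suc k, i))"
  have abs: "f abs_summable_on UNIV"
    unfolding f_def by (rule toeplitz_abs_summable[OF r v c])
  have fs: "f summable_on A" for A
    by (rule summable_on_subset_banach[OF abs_summable_summable[OF abs]]) simp
  have inj: "inj up" "inj dn" by (auto simp: inj_def up_def dn_def)
  have f_up: "f (up p) = g p" for p
    using even[of "int (fst p)"] by (cases p) (simp add: f_def g_def up_def)
  have f_dn: "f (dn (k, i)) = g (Suc k, i)" for k i
    by (simp add: f_def g_def dn_def mult_ac add_ac)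
  have inner: "((\<lambda>i. g (k, i)) has_sum t k) UNIV" for k
  proof -
    have vs: "(\<lambda>i. v i * v (i + k)) summable_on UNIV"
      by (rule abs_summable_summable[OF summable_autocorrelation[OF r v]])
    have "infsum (\<lambda>i. v i * v (i + k)) UNIV = (\<Sum>i. v i * v (i + k))"
      using has_sum_imp_sums[OF has_sum_infsum[OF vs]] by (simp add: sums_iff)
    then show ?thesis
      using has_sum_cmult_right[OF has_sum_infsum[OF vs], of "c (int k)"]
      by (simp add: g_def t_def)
  qed
  have cover: "range up \<union> range dn = UNIV"
  proof (intro equalityI subsetI UNIV_I)
    fix p :: "nat \<times> nat"
    obtain a b where p: "p = (a, b)" by (cases p)
    have "p = up (b - a, a)" if "a \<le> b" using that by (simp add: p up_def)
    moreover have "p = dn (a - Suc b, b)" if "\<not> a \<le> b" using that by (simp add: p dn_def)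
    ultimately show "p \<in> range up \<union> range dn" by blast
  qed
  have disj: "range up \<inter> range dn = {}" by (auto simp: up_def dn_def)
  have up_sum: "(g has_sum infsum f (range up)) (UNIV \<times> UNIV)"
    using has_sum_infsum[OF fs, of "range up"] inj by (simp add: has_sum_reindex o_def f_up)
  have dn_sum: "((\<lambda>(k, i). g (Suc k, i)) has_sum infsum f (range dn)) (UNIV \<times> UNIV)"
    using has_sum_infsum[OF fs, of "range dn"] inj
    by (simp add: has_sum_reindex o_def case_prod_unfold flip: f_dn)
  have t0: "t sums infsum f (range up)"
    by (intro has_sum_imp_sums has_sum_Sigma'[OF up_sum] inner)
  have "(\<lambda>k. t (Suc k)) sums infsum f (range dn)"
    by (intro has_sum_imp_sums has_sum_Sigma'[OF dn_sum]) (simp add: inner)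
  then have t1: "(\<lambda>k. if k = 0 then 0 else t k) sums infsum f (range dn)"
    by (subst (asm) sums_Suc_iff[where f = "\<lambda>k. if k = 0 then 0 else t k", simplified])
  have "toeplitz_sum c v = infsum f (range up \<union> range dn)"
    by (simp add: cover toeplitz_sum_def f_def)
  also have "\<dots> = infsum f (range up) + infsum f (range dn)"
    by (intro infsum_Un_disjoint fs disj)
  finally have "(\<lambda>k. t k + (if k = 0 then 0 else t k)) sums toeplitz_sum c v"
    using sums_add[OF t0 t1] by simp
  moreover have "(\<lambda>k. t k + (if k = 0 then 0 else t k)) =
      (\<lambda>k. (if k = 0 then 1 else 2) * c (int k) * (\<Sum>i. v i * v (i + k)))"
    by (auto simp: t_def)
  ultimately show ?thesis by simp
qed

section \<open>The generating function identity\<close>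

lemma norm_eq_1_if_square_eq_1:
  fixes s :: complex
  assumes "s * s = 1"
  shows "norm s = 1"
proof -
  have "norm s ^ 2 = 1"
    using assms by (simp add: power2_eq_square flip: norm_mult)
  then show ?thesis
    using norm_ge_zero[of s] unfolding power2_eq_1_iff by linarith
qed

text \<open>Removing the variable \<open>x m\<close> relates \<open>F m j\<close> to
  \<open>F (Suc m) j\<close> and \<open>F (Suc m) (j - 1)\<close>. After scaling by the squared
  product this is the recursion of \<open>chsym\<close> in the variables
  \<open>x n / (1 - s * x n)\<^sup>2\<close>.\<close>

lemma chsym_ratio_eq:
  fixes x :: "nat \<Rightarrow> complex"
  assumes s: "s * s = 1" and x: "\<And>n. norm (x n) \<le> \<rho>" and r: "r > 1" "r * \<rho> < 1"
  shows "chsym (\<lambda>n. x n / (1 - s * x n)\<^sup>2) m j =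
    (\<Prod>n<m. 1 - s * x n)\<^sup>2 * toeplitz_sum (ccoeff s j) (chsym x m)"
proof -
  have ns: "norm s = 1" using s by (rule norm_eq_1_if_square_eq_1)
  have nz: "1 - s * x n \<noteq> 0" for n
  proof
    assume "1 - s * x n = 0"
    then have "norm (s * x n) = 1" by simp
    then have "\<rho> \<ge> 1" using x[of n] by (simp add: norm_mult ns)
    then have "1 * 1 \<le> r * \<rho>" using r(1) by (intro mult_mono) auto
    then show False using r(2) by simp
  qed
  define F where "F m j = toeplitz_sum (ccoeff s j) (chsym x m)" for m j
  have F_Suc: "F m j = (1 - s * x m)\<^sup>2 * F (Suc m) j - x m * (if j = 0 then 0 else F (Suc m) (j - 1))"
    for m j
  proof -
    obtain K where K: "\<And>d. norm (ccoeff s j d) \<le> K * r ^ nat \<bar>d\<bar>"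
      using norm_ccoeff_le[OF ns r(1)] by blast
    obtain L where L: "\<And>d. norm (ccoeff s (j - 1) d) \<le> L * r ^ nat \<bar>d\<bar>"
      using norm_ccoeff_le[OF ns r(1)] by blast
    \<comment> \<open>For \<open>j = 0\<close> no lower coefficient of t exists, so the
      inhomogeneous term vanishes.\<close>
    define e where "e d = (if j = 0 then 0 else ccoeff s (j - 1) d)" for d
    have e: "norm (e d) \<le> (if j = 0 then 0 else L) * r ^ nat \<bar>d\<bar>" for d
      using L by (simp add: e_def)
    have "F m j = (1 - 2 * s * x m + (x m)\<^sup>2) * F (Suc m) j - x m * toeplitz_sum e (chsym x (Suc m))"
      unfolding F_def
      by (rule toeplitz_sum_geometric_factor[OF _ summable_chsym[OF x _ r(2)] K e])
        (use r ccoeff_recurrence[OF s] in \<open>auto simp: e_def\<close>)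
    moreover have "toeplitz_sum e (chsym x (Suc m)) = (if j = 0 then 0 else F (Suc m) (j - 1))"
      by (auto simp: F_def toeplitz_sum_def e_def cong: infsum_cong)
    moreover have "1 - 2 * s * x m + (x m)\<^sup>2 = (1 - s * x m)\<^sup>2"
      using s by (simp add: power2_eq_square algebra_simps)
    ultimately show ?thesis by simp
  qed
  have F_0: "F 0 j = (if j = 0 then 1 else 0)" for j
  proof -
    have "((\<lambda>(a, b). ccoeff s j (int a - int b) * chsym x 0 a * chsym x 0 b)
        has_sum ccoeff s j 0) UNIV"
      by (rule has_sum_finite_neutralI[where B = "{(0, 0)}"]) (auto split: if_splits)
    then have "F 0 j = ccoeff s j 0"
      unfolding F_def toeplitz_sum_def by (rule infsumI)
    also have "\<dots> = (if j = 0 then 1 else 0)"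
      by (cases j) (auto simp: ccoeff_def Bsym_0_right Bsym_0_left)
    finally show ?thesis .
  qed
  \<comment> \<open>\<open>chsym\<close> has value 1 at degree 0 without recursing in
    \<open>m\<close>, so this degree needs its own induction.\<close>
  have F_right_0: "(\<Prod>n<m. 1 - s * x n)\<^sup>2 * F m 0 = 1" for m
  proof (induction m)
    case (Suc m)
    then show ?case
      using F_Suc[of m 0] by (simp add: power_mult_distrib mult_ac)
  qed (simp add: F_0)
  have "chsym (\<lambda>n. x n / (1 - s * x n)\<^sup>2) m j = (\<Prod>n<m. 1 - s * x n)\<^sup>2 * F m j"
  proof (induction "\<lambda>n. x n / (1 - s * x n)\<^sup>2" m j rule: chsym.induct)
    case (1 j)
    then show ?case by (simp add: F_0)
  next
    case (2 m)
    then show ?case using F_right_0[of "Suc m"] by simp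
  next
    case (3 m j)
    have "(1 - s * x m)\<^sup>2 * F (Suc m) (Suc j) = F m (Suc j) + x m * F (Suc m) j"
      using F_Suc[of m "Suc j"] by simp
    moreover have "chsym (\<lambda>n. x n / (1 - s * x n)\<^sup>2) (Suc m) (Suc j) =
       (\<Prod>n<m. 1 - s * x n)\<^sup>2 * (F m (Suc j) + x m * F (Suc m) j)"
      using nz[of m] unfolding chsym.simps 3(1) 3(2)
      by (simp add: power_mult_distrib) (simp add: algebra_simps)
    ultimately show ?case
      by (simp add: power_mult_distrib mult_ac)
  qed
  then show ?thesis by (simp add: F_def)
qed

lemma chsym_ratio_sums:
  fixes x :: "nat \<Rightarrow> complex"
  assumes s: "s * s = 1" and x: "\<And>n. norm (x n) \<le> \<rho>" and \<rho>: "\<rho> < 1"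
  shows "\<exists>S. (\<lambda>n. s ^ n * B (j + n) j * (\<Sum>i. chsym x m i * chsym x m (i + (j + n)))) sums S \<and>
    chsym (\<lambda>n. x n / (1 - s * x n)\<^sup>2) m j = (\<Prod>n<m. 1 - s * x n)\<^sup>2 * S"
    and "summable (\<lambda>i. chsym x m i * chsym x m (i + k))"
proof -
  have \<rho>0: "\<rho> \<ge> 0" using x[of 0] norm_ge_zero order_trans by blast
  \<comment> \<open>The reciprocal of the midpoint of \<open>\<rho>\<close> and 1, which gives both
    \<open>r > 1\<close> and \<open>r * \<rho> < 1\<close>.\<close>
  define r where "r = 2 / (1 + \<rho>)"
  have r: "r > 1" "r * \<rho> < 1" using \<rho> \<rho>0 by (auto simp: r_def field_simps)
  have ns: "norm s = 1" using s by (rule norm_eq_1_if_square_eq_1)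
  have v: "summable (\<lambda>a. norm (chsym x m a) * r ^ a)"
    using summable_chsym[OF x _ r(2)] r(1) by simp
  have r1: "r \<ge> 1" using r by simp
  show "summable (\<lambda>i. chsym x m i * chsym x m (i + k))"
    by (rule summable_on_imp_summable[OF abs_summable_summable[OF summable_autocorrelation[OF r1 v]]])
  obtain K where K: "\<And>d. norm (ccoeff s j d) \<le> K * r ^ nat \<bar>d\<bar>"
    using norm_ccoeff_le[OF ns r(1)] by blast
  define G where "G k = (\<Sum>i. chsym x m i * chsym x m (i + k))" for k
  \<comment> \<open>The diagonal multiplicity 2 cancels the halving in \<open>ccoeff\<close>; for
    \<open>k = 0\<close> and \<open>j = 0\<close> multiplicity 1 turns \<open>Bsym 0 0 = 2\<close>
    into \<open>B 0 0 = 1\<close>.\<close>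
  have coeff: "(if k = 0 then 1 else 2) * ccoeff s j (int k) = s ^ (k + j) * B k j" for k
  proof (cases "k + j \<ge> 1")
    case True
    have "B k j = 0" if "k = 0" using True that by (simp add: B_def)
    then show ?thesis
      using Bsym_eq_B[OF True] by (auto simp: ccoeff_def)
  next
    case False
    then have "k = 0" "j = 0" by simp_all
    then show ?thesis by (simp add: ccoeff_def B_def Bsym_0_right)
  qed
  have "(\<lambda>k. s ^ (k + j) * B k j * G k) sums toeplitz_sum (ccoeff s j) (chsym x m)"
    using toeplitz_sum_by_diagonals[OF r1 v K ccoeff_uminus] by (simp add: coeff flip: G_def)
  \<comment> \<open>The binomial in \<open>B\<close> vanishes below \<open>j\<close>, so the series
    may start at \<open>k = j\<close>; the surplus sign \<open>s ^ (2 * j)\<close> is 1.\<close>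
  moreover have "s ^ (k + j) * B k j * G k = 0" if "k < j" for k
    using that by (simp add: B_def)
  ultimately have "(\<lambda>n. s ^ (n + j + j) * B (n + j) j * G (n + j)) sums
      toeplitz_sum (ccoeff s j) (chsym x m)"
    by (subst sums_zero_iff_shift) auto
  moreover have "s ^ (n + j + j) = s ^ n" for n
    using s by (simp add: power_add mult.assoc flip: power_mult_distrib)
  ultimately have "(\<lambda>n. s ^ n * B (j + n) j * G (j + n)) sums
      toeplitz_sum (ccoeff s j) (chsym x m)"
    by (simp add: add.commute)
  then show "\<exists>S. (\<lambda>n. s ^ n * B (j + n) j * (\<Sum>i. chsym x m i * chsym x m (i + (j + n)))) sums S \<and>
      chsym (\<lambda>n. x n / (1 - s * x n)\<^sup>2) m j = (\<Prod>n<m. 1 - s * x n)\<^sup>2 * S"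
    using chsym_ratio_eq[where x = x, OF s x r] unfolding G_def by blast
qed

section \<open>Geometric variables and the series in \<open>H\<close>\<close>

lemma chsym_ratio_eq_H_series:
  assumes s: "s * s = 1" and q: "norm q < 1" and p: "norm p < 1" and m: "m \<ge> 1"
  shows "summable (H_term k m p (q\<^sup>2))"
    and "summable (\<lambda>n. s ^ n * B (j + n) j * q ^ (j + n) * H (j + n) m p (q\<^sup>2))"
    and "chsym (\<lambda>n. q * p ^ n / (1 - s * (q * p ^ n))\<^sup>2) m j = (qpoch (s * q) p m)\<^sup>2 *
      (\<Sum>n. s ^ n * B (j + n) j * q ^ (j + n) * H (j + n) m p (q\<^sup>2))"
proof -
  define x where "x n = q * p ^ n" for n
  have x: "norm (x n) \<le> norm q" for n
    using p by (simp add: x_def norm_mult norm_power mult_left_le power_le_one)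
  have H: "q ^ k * H_term k m p (q\<^sup>2) i = chsym x m i * chsym x m (i + k)" for k i
    using H_term_mult_power[OF p m] by (simp add: x_def[abs_def])
  show summ: "summable (H_term k m p (q\<^sup>2))" for k
  \<comment> \<open>The factor \<open>q ^ k\<close> cannot be cancelled when \<open>q = 0\<close>,
    but then only the term \<open>i = 0\<close> can be nonzero.\<close>
  proof (cases "q = 0")
    case True
    then show ?thesis
      by (intro summable_finite[of "{0}"]) (auto simp: H_term_def)
  next
    case False
    have "summable (\<lambda>i. q ^ k * H_term k m p (q\<^sup>2) i)"
      unfolding H by (rule chsym_ratio_sums(2)[OF s x q])
    then show ?thesis using False by (simp add: summable_cmult_iff)
  qed
  have "(\<Sum>i. chsym x m i * chsym x m (i + k)) = q ^ k * H k m p (q\<^sup>2)" for k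
    unfolding H_def H[symmetric] by (rule suminf_mult[OF summ])
  then obtain S where S: "(\<lambda>n. s ^ n * B (j + n) j * q ^ (j + n) * H (j + n) m p (q\<^sup>2)) sums S"
    "chsym (\<lambda>n. x n / (1 - s * x n)\<^sup>2) m j = (\<Prod>n<m. 1 - s * x n)\<^sup>2 * S"
    using chsym_ratio_sums(1)[where x = x, OF s x q, of j m] by (auto simp: mult.assoc)
  then show "summable (\<lambda>n. s ^ n * B (j + n) j * q ^ (j + n) * H (j + n) m p (q\<^sup>2))"
    by (simp add: sums_iff)
  show "chsym (\<lambda>n. q * p ^ n / (1 - s * (q * p ^ n))\<^sup>2) m j = (qpoch (s * q) p m)\<^sup>2 *
      (\<Sum>n. s ^ n * B (j + n) j * q ^ (j + n) * H (j + n) m p (q\<^sup>2))"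
    using S by (simp add: sums_iff x_def qpoch_def mult.assoc)
qed

theorem theorem2:
  fixes j m :: nat and q s :: complex
  assumes "m \<ge> 1" and "norm q < 1" and "s \<in> {1, -1}"
  shows
    "((\<forall>k\<ge>j. summable (H_term k m q (q\<^sup>2))) \<and>
      summable (\<lambda>n. s ^ n * B (j + n) j * q ^ (j + n) * H (j + n) m q (q\<^sup>2)) \<and>
      V s j m q = (qpoch (s * q) q m)\<^sup>2 *
        (\<Sum>n. s ^ n * B (j + n) j * q ^ (j + n) * H (j + n) m q (q\<^sup>2))) \<and>
     ((\<forall>k\<ge>j. summable (H_term k m (q\<^sup>2) (q\<^sup>2))) \<and>
      summable (\<lambda>n. s ^ n * B (j + n) j * q ^ (j + n) * H (j + n) m (q\<^sup>2) (q\<^sup>2)) \<and>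
      W s j m q = (qpoch (s * q) (q\<^sup>2) m)\<^sup>2 *
        (\<Sum>n. s ^ n * B (j + n) j * q ^ (j + n) * H (j + n) m (q\<^sup>2) (q\<^sup>2)))"
proof -
  have s: "s * s = 1" using assms(3) by auto
  have q2: "norm (q\<^sup>2) < 1" using assms(2) by (simp add: norm_power power_less_one_iff)
  have V: "V s j m q = chsym (\<lambda>n. q * q ^ n / (1 - s * (q * q ^ n))\<^sup>2) m j"
    unfolding V_def
    by (subst sum_nondecr_tuples_eq_chsym[where f = "\<lambda>n. q ^ n / (1 - s * q ^ n)\<^sup>2"]) simp
  \<comment> \<open>Tuple entries start at 1 and variables at 0, so the exponent
    \<open>2 * Suc n - 1\<close> is \<open>2 * n + 1\<close>, giving base \<open>q\<^sup>2\<close>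
    with first term \<open>q\<close>.\<close>
  have W: "W s j m q = chsym (\<lambda>n. q * (q\<^sup>2) ^ n / (1 - s * (q * (q\<^sup>2) ^ n))\<^sup>2) m j"
    unfolding W_def
    by (subst sum_nondecr_tuples_eq_chsym[where f = "\<lambda>n. q ^ (2 * n - 1) / (1 - s * q ^ (2 * n - 1))\<^sup>2"])
      (simp add: power_mult)
  show ?thesis
    unfolding V W
    by (intro conjI allI impI chsym_ratio_eq_H_series[OF s assms(2) assms(2) assms(1)]
        chsym_ratio_eq_H_series[OF s assms(2) q2 assms(1)])
qed

end
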